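(* Let $G_n=G_n(g,zg)$ be an io-decomposable Riordan graph of the Bell type on $n$ vertices. If $2^k<n\le 2^{k+1}$ for an integer $k\ge 2$, then $$i(G_n)\le \delta_n-(\delta_{2^k-2}-1)\,\tilde\delta_{n-2^k-3}-\tilde\delta_{n-2^k-1}\sum_{i=1}^{k-1}(\delta_{2^i-2}-1)\,\tilde\delta_{2^i-3}\,\alpha_{i+1},$$ where $\tilde\delta_m=1$ for $m<0$, and $\alpha_{i+1}=1$ if $i=k-1$, while $\alpha_{i+1}=\prod_{j=i+1}^{k-1}\tilde\delta_{2^j-1}$ otherwise.
   Context: For a finite simple graph $G$, $i(G)$ is the number of independent sets of $G$ (sets of pairwise non-adjacent vertices), including the empty set. Riordan graph: let $g=\sum_{m\ge0}g_mz^m$ and $f=\sum_{m\ge1}f_mz^m$ be formal power series in $\mathbb{Z}[[z]]$, and let $[z^m]h$ denote the coefficient of $z^m$ in $h$. The Riordan graph $G_n(g,f)$ is the simple graph with vertex set $\{1,\ldots,n\}$ in which, for $i>j$, the vertices $i$ and $j$ are adjacent if and only if $[z^{i-2}]\,gf^{\,j-1}\equiv1\pmod2$. It is proper if $[z^0]g\equiv[z^1]f\equiv1\pmod2$. It is of the Bell type if $f=zg$. Let $\langle V_o\rangle$ and $\langle V_e\rangle$ be the subgraphs of $G_n(g,f)$ induced by the odd vertices and by the even vertices, respectively. A proper Riordan graph $G_n(g,f)$ is io-decomposable (isomorphically odd decomposable) if $\langle V_o\rangle\cong G_{\lceil n/2\rceil}(g,f)$ and $\langle V_e\rangle$ is a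 null graph (has no edges). Auxiliary numbers: for $n\ge 1$, let $\Delta_n$ and $\tilde\Delta_n$ be the graphs with vertex set $\{1,\ldots,n\}$ and edge sets $$E(\Delta_n)=\{i(i+1)\mid 1\le i<n\}\cup\{(2i-1)(2i+1)\mid 1\le i\le\lfloor(n-1)/2\rfloor\},$$ $$E(\tilde\Delta_n)=\{i(i+1)\mid 1\le i<n\}\cup\{(2i)(2i+2)\mid 1\le i\le\lfloor(n-2)/2\rfloor\}.$$ Put $\delta_n=i(\Delta_n)$ and $\tilde\delta_n=i(\tilde\Delta_n)$ for $n\ge1$, and $\delta_0=\tilde\delta_0=1$.
   Formalization: The isomorphism of ⟨V_o⟩ with G_{⌈n/2⌉}(g,f) is taken to preserve the order of labels (2i-1 ↦ i); with arbitrary graph isomorphism the claim fails, e.g. g=1+z^3+z^5, n=7, where i(G_7)=25 exceeds the bound 22. *)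

theory Defs
  imports
    "Graph_Theory.Graph_Theory"
    "HOL-Computational_Algebra.Formal_Power_Series"
begin

text \<open>
  Simple graphs are symmetric loop-free digraphs, as in the locale \<open>graph\<close> of \<open>Graph_Theory\<close>:
  an undirected edge \<open>{u, v}\<close> is the pair of arcs \<open>(u, v)\<close>, \<open>(v, u)\<close>.
\<close>

definition graph_on :: "nat \<Rightarrow> nat rel \<Rightarrow> (nat, nat \<times> nat) pre_digraph" where
  "graph_on n E = \<lparr> verts = {1..n}, arcs = E \<union> E\<inverse>, tail = fst, head = snd \<rparr>"

lemma graph_graph_on:
  assumes "E \<subseteq> {1..n} \<times> {1..n}" "irrefl E"
  shows "graph (graph_on n E)"
proof -
  have "finite (E \<union> E\<inverse>)"
    using assms(1) finite_subset[of E "{1..n} \<times> {1..n}"] by simp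
  then show ?thesis
    using assms
    by unfold_locales
      (auto simp: graph_on_def arc_to_ends_def arcs_ends_def symmetric_def irrefl_def
        intro!: symI split: prod.splits)
qed

definition independent_set :: "('a, 'b) pre_digraph \<Rightarrow> 'a set \<Rightarrow> bool" where
  "independent_set G S \<longleftrightarrow> S \<subseteq> verts G \<and> (\<forall>u\<in>S. \<forall>v\<in>S. \<not> u \<rightarrow>\<^bsub>G\<^esub> v)"

definition num_independent_sets :: "('a, 'b) pre_digraph \<Rightarrow> nat" where
  "num_independent_sets G = card {S. independent_set G S}"


text \<open>
  The series \<open>f\<close> is meant to have zero constant term; for the Bell type, where
  \<open>f = fps_X * g\<close>, this is automatic. The subtraction \<open>i - 2\<close> does not truncate, since \<open>i > j \<ge> 1\<close>.
\<close>

definition riordan_graph :: "nat \<Rightarrow> int fps \<Rightarrow> int fps \<Rightarrow> (nat, nat \<times> nat) pre_digraph" where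
  "riordan_graph n g f = graph_on n
     {(i, j). i \<in> {1..n} \<and> j \<in> {1..n} \<and> i > j \<and> odd (fps_nth (g * f ^ (j - 1)) (i - 2))}"

lemma graph_riordan_graph: "graph (riordan_graph n g f)"
  unfolding riordan_graph_def by (rule graph_graph_on) (auto simp: irrefl_def)

definition proper_riordan :: "int fps \<Rightarrow> int fps \<Rightarrow> bool" where
  "proper_riordan g f \<longleftrightarrow> odd (fps_nth g 0) \<and> odd (fps_nth f 1)"

text \<open>
  Riordan graphs are labelled graphs, and the isomorphism between \<open>\<langle>V\<^sub>o\<rangle>\<close> and
  \<open>G\<^bsub>\<lceil>n/2\<rceil>\<^esub>(g, f)\<close> is read as one of labelled graphs: it respects the order of the labels, so
  it is forced to be \<open>2 * i - 1 \<mapsto> i\<close>. Equivalently, the two adjacency matrices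
  coincide. The distinction matters: for \<open>g = 1 + z^3 + z^5\<close>, \<open>f = z * g\<close> and \<open>n = 7\<close>
  the odd vertices induce the path \<open>5, 1, 7, 3\<close>, whereas \<open>G\<^sub>4(g, f)\<close> is the path
  \<open>1, 2, 3, 4\<close>; these are isomorphic only after relabelling, and this \<open>G\<^sub>7(g, f)\<close> has
  25 independent sets, more than the 22 that the bound for io-decomposable graphs allows.
\<close>

definition labelled_iso ::
  "('a::linorder, 'b) pre_digraph \<Rightarrow> ('c::linorder, 'd) pre_digraph \<Rightarrow> bool" where
  "labelled_iso G H \<longleftrightarrow>
     (\<exists>h. pre_digraph.digraph_isomorphism G h \<and> H = app_iso h G \<and>
          strict_mono_on (verts G) (iso_verts h))"

lemma labelled_iso_imp_digraph_iso: "labelled_iso G H \<Longrightarrow> digraph_iso G H"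
  by (auto simp: labelled_iso_def digraph_iso_def)

definition io_decomposable :: "nat \<Rightarrow> int fps \<Rightarrow> int fps \<Rightarrow> bool" where
  "io_decomposable n g f \<longleftrightarrow>
     proper_riordan g f \<and>
     labelled_iso (riordan_graph n g f \<restriction> {v \<in> {1..n}. odd v})
                  (riordan_graph (nat \<lceil>real n / 2\<rceil>) g f) \<and>
     arcs (riordan_graph n g f \<restriction> {v \<in> {1..n}. even v}) = {}"


definition Delta_graph :: "nat \<Rightarrow> (nat, nat \<times> nat) pre_digraph" where
  "Delta_graph n = graph_on n
     ({(i, i + 1) | i. 1 \<le> i \<and> i < n} \<union>
      {(2 * i - 1, 2 * i + 1) | i. 1 \<le> i \<and> i \<le> (n - 1) div 2})"

definition Delta_tilde_graph :: "nat \<Rightarrow> (nat, nat \<times> nat) pre_digraph" where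
  "Delta_tilde_graph n = graph_on n
     ({(i, i + 1) | i. 1 \<le> i \<and> i < n} \<union>
      {(2 * i, 2 * i + 2) | i. 1 \<le> i \<and> i \<le> (n - 2) div 2})"

lemma graph_Delta_graph: "graph (Delta_graph n)"
  unfolding Delta_graph_def by (rule graph_graph_on) (auto simp: irrefl_def)

lemma graph_Delta_tilde_graph: "graph (Delta_tilde_graph n)"
  unfolding Delta_tilde_graph_def by (rule graph_graph_on) (auto simp: irrefl_def)

definition delta :: "nat \<Rightarrow> nat" where
  "delta n = (if n = 0 then 1 else num_independent_sets (Delta_graph n))"

text \<open>Integer indices, because of the convention that the value is 1 at negative indices.\<close>

definition delta_tilde :: "int \<Rightarrow> nat" where
  "delta_tilde m = (if m \<le> 0 then 1 else num_independent_sets (Delta_tilde_graph (nat m)))"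

definition alpha :: "nat \<Rightarrow> nat \<Rightarrow> nat" where
  "alpha k i = (if i = k then 1 else (\<Prod>j = i..k - 1. delta_tilde (2 ^ j - 1)))"

end

theory Submission
  imports Defs
begin

text \<open>
  Every \<open>G\<^sub>n(g, zg)\<close> as in the theorem contains \<open>\<Delta>\<^sub>n\<close>, and in it each vertex
  \<open>2\<^sup>i + 1\<close> is adjacent to all smaller vertices: writing \<open>a \<sim> b\<close> for adjacency,
  \<open>a \<sim> b\<close> implies \<open>2a - 1 \<sim> 2b - 1\<close> by io-decomposability, and
  \<open>2a - 1 \<sim> 2b\<close> because \<open>g\<^sup>2 \<equiv> g(z\<^sup>2)\<close> modulo 2. Hence the independent sets of \<open>G\<^sub>n\<close> are
  among those of \<open>\<Delta>\<^sub>n\<close>, and none of them contains some \<open>2\<^sup>i + 1\<close> together with a vertex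
  below \<open>2\<^sup>i - 1\<close>. The subtracted terms count the independent sets of \<open>\<Delta>\<^sub>n\<close> so excluded,
  classified by the largest \<open>i\<close> with \<open>2\<^sup>i + 1\<close> in the set.
\<close>

section \<open>Independent sets of the auxiliary graphs\<close>

text \<open>One relation on all naturals serves both auxiliary graphs: the interval from 1 to
  \<open>n\<close> induces \<open>Delta_graph n\<close>, and an interval that starts at a positive
  even number induces a shifted copy of a \<open>Delta_tilde_graph\<close>.\<close>

definition delta_adj :: "nat \<Rightarrow> nat \<Rightarrow> bool" where
  "delta_adj u v \<longleftrightarrow> v = u + 1 \<or> u = v + 1 \<or> odd u \<and> v = u + 2 \<or> odd v \<and> u = v + 2"

definition delta_indep :: "nat set \<Rightarrow> nat set set" where
  "delta_indep A = {S. S \<subseteq> A \<and> (\<forall>u\<in>S. \<forall>v\<in>S. \<not> delta_adj u v)}"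

lemma delta_adj_commute: "delta_adj u v \<longleftrightarrow> delta_adj v u"
  by (auto simp: delta_adj_def)

lemma delta_indep_subset_Pow: "delta_indep A \<subseteq> Pow A"
  by (auto simp: delta_indep_def)

lemma finite_delta_indep: "finite A \<Longrightarrow> finite (delta_indep A)"
  using delta_indep_subset_Pow finite_subset by blast

lemma delta_indep_empty [simp]: "delta_indep {} = {{}}"
  by (auto simp: delta_indep_def)

lemma empty_in_delta_indep [simp]: "{} \<in> delta_indep A"
  by (auto simp: delta_indep_def)

lemma singleton_in_delta_indep [simp]: "{c} \<in> delta_indep {c}"
  by (auto simp: delta_indep_def delta_adj_def)

lemma delta_indep_mono: "S \<in> delta_indep A \<Longrightarrow> A \<subseteq> B \<Longrightarrow> S \<in> delta_indep B"
  by (auto simp: delta_indep_def)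

lemma delta_indep_Un:
  assumes "S \<in> delta_indep A" "T \<in> delta_indep B"
    and "\<And>u v. u \<in> A \<Longrightarrow> v \<in> B \<Longrightarrow> \<not> delta_adj u v"
  shows "S \<union> T \<in> delta_indep (A \<union> B)"
  using assms delta_adj_commute unfolding delta_indep_def by blast

lemma dominates_graph_on: "u \<rightarrow>\<^bsub>graph_on n E\<^esub> v \<longleftrightarrow> (u, v) \<in> E \<or> (v, u) \<in> E"
  by (auto simp: graph_on_def arcs_ends_def arc_to_ends_def)

lemma verts_graph_on [simp]: "verts (graph_on n E) = {1..n}"
  by (simp add: graph_on_def)

lemma dominates_Delta_graph:
  assumes "u \<in> {1..n}" "v \<in> {1..n}"
  shows "u \<rightarrow>\<^bsub>Delta_graph n\<^esub> v \<longleftrightarrow> delta_adj u v"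
proof -
  have 1: "(u, v) \<in> {(i, i + 1) | i. 1 \<le> i \<and> i < n} \<longleftrightarrow> v = u + 1"
    if "u \<in> {1..n}" "v \<in> {1..n}" for u v
    using that by auto
  have 2: "(u, v) \<in> {(2 * i - 1, 2 * i + 1) | i. 1 \<le> i \<and> i \<le> (n - 1) div 2} \<longleftrightarrow> odd u \<and> v = u + 2"
    if "u \<in> {1..n}" "v \<in> {1..n}" for u v
  proof
    assume "odd u \<and> v = u + 2"
    then obtain m where "u = 2 * m + 1" "v = u + 2" by (auto elim: oddE)
    then have "(u, v) = (2 * (m + 1) - 1, 2 * (m + 1) + 1)" "1 \<le> m + 1" "m + 1 \<le> (n - 1) div 2"
      using that by auto
    then show "(u, v) \<in> {(2 * i - 1, 2 * i + 1) | i. 1 \<le> i \<and> i \<le> (n - 1) div 2}" by blast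
  qed auto
  show ?thesis
    unfolding Delta_graph_def dominates_graph_on delta_adj_def Un_iff 1[OF assms] 2[OF assms]
      1[OF assms(2,1)] 2[OF assms(2,1)] by blast
qed

text \<open>A shift by an odd \<open>a\<close> swaps parities, so the chords between even vertices
  become chords between odd ones.\<close>

lemma dominates_Delta_tilde_graph:
  assumes "u \<in> {1..n}" "v \<in> {1..n}" "odd a"
  shows "u \<rightarrow>\<^bsub>Delta_tilde_graph n\<^esub> v \<longleftrightarrow> delta_adj (a + u) (a + v)"
proof -
  have 1: "(u, v) \<in> {(i, i + 1) | i. 1 \<le> i \<and> i < n} \<longleftrightarrow> a + v = a + u + 1"
    if "u \<in> {1..n}" "v \<in> {1..n}" for u v
    using that by auto
  have 2: "(u, v) \<in> {(2 * i, 2 * i + 2) | i. 1 \<le> i \<and> i \<le> (n - 2) div 2}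
      \<longleftrightarrow> odd (a + u) \<and> a + v = a + u + 2"
    if "u \<in> {1..n}" "v \<in> {1..n}" for u v
  proof
    assume "odd (a + u) \<and> a + v = a + u + 2"
    then obtain m where "u = 2 * m" "v = u + 2" using assms(3) by (auto elim: evenE)
    then have "(u, v) = (2 * m, 2 * m + 2)" "1 \<le> m" "m \<le> (n - 2) div 2"
      using that by auto
    then show "(u, v) \<in> {(2 * i, 2 * i + 2) | i. 1 \<le> i \<and> i \<le> (n - 2) div 2}" by blast
  qed (use assms(3) in auto)
  show ?thesis
    unfolding Delta_tilde_graph_def dominates_graph_on delta_adj_def Un_iff
      1[OF assms(1,2)] 2[OF assms(1,2)] 1[OF assms(2,1)] 2[OF assms(2,1)] by blast
qed

lemma delta_eq_card: "delta n = card (delta_indep {1..n})"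
proof (cases "n = 0")
  case False
  have "{S. independent_set (Delta_graph n) S} = delta_indep {1..n}"
    unfolding independent_set_def delta_indep_def
    using dominates_Delta_graph[of _ n] by (auto simp: Delta_graph_def subset_iff)
  with False show ?thesis by (simp add: delta_def num_independent_sets_def)
qed (simp add: delta_def)

text \<open>The shift by \<open>a\<close> carries independent sets to independent sets. If
  \<open>N \<le> a\<close> the interval is empty and only the empty set is counted, in accordance
  with the value 1 at indices up to 0.\<close>

lemma delta_tilde_eq_card:
  assumes "odd a"
  shows "delta_tilde (int N - int a) = card (delta_indep {a + 1..N})"
proof (cases "N \<le> a")
  case False
  define m where "m = N - a"
  have N: "N = a + m" using False by (simp add: m_def)
  have "bij_betw ((`) ((+) a)) {S. independent_set (Delta_tilde_graph m) S} (delta_indep {a + 1..a + m})"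
  proof (rule bij_betwI')
    fix S T :: "nat set"
    show "((+) a ` S = (+) a ` T) = (S = T)" by (simp add: inj_image_eq_iff)
  next
    fix S assume "S \<in> {S. independent_set (Delta_tilde_graph m) S}"
    then have S: "S \<subseteq> {1..m}" and I: "\<And>u v. u \<in> S \<Longrightarrow> v \<in> S \<Longrightarrow> \<not> u \<rightarrow>\<^bsub>Delta_tilde_graph m\<^esub> v"
      by (auto simp: independent_set_def Delta_tilde_graph_def)
    have "\<not> delta_adj (a + u) (a + v)" if "u \<in> S" "v \<in> S" for u v
      using I[OF that] dominates_Delta_tilde_graph[of u m v a] S that assms by blast
    then show "(+) a ` S \<in> delta_indep {a + 1..a + m}"
      using S by (auto simp: delta_indep_def)
  next
    fix T assume T: "T \<in> delta_indep {a + 1..a + m}"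
    define S where "S = {u. a + u \<in> T}"
    have S: "S \<subseteq> {1..m}" using T by (auto simp: S_def delta_indep_def)
    have "\<not> u \<rightarrow>\<^bsub>Delta_tilde_graph m\<^esub> v" if "u \<in> S" "v \<in> S" for u v
    proof -
      have "\<not> delta_adj (a + u) (a + v)" using T that by (simp add: S_def delta_indep_def)
      then show ?thesis using dominates_Delta_tilde_graph[of u m v a] S that assms by blast
    qed
    then have "independent_set (Delta_tilde_graph m) S"
      using S by (auto simp: independent_set_def Delta_tilde_graph_def)
    moreover have "T = (+) a ` S"
    proof (intro set_eqI iffI)
      fix x assume "x \<in> T"
      moreover from this have "a \<le> x" using T by (auto simp: delta_indep_def)
      ultimately show "x \<in> (+) a ` S"
        by (auto simp: S_def intro!: image_eqI[of _ _ "x - a"])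
    qed (auto simp: S_def)
    ultimately show "\<exists>S\<in>{S. independent_set (Delta_tilde_graph m) S}. T = (+) a ` S" by blast
  qed
  then show ?thesis
    using False by (simp add: N delta_tilde_def num_independent_sets_def bij_betw_same_card)
qed (simp add: delta_tilde_def)

text \<open>Intersecting \<open>S \<union> T \<union> C\<close> with the disjoint sets
  \<open>A\<close> and \<open>B\<close> recovers \<open>S\<close> and \<open>T\<close>, so the union
  map is injective. \<open>C\<close> holds vertices common to all the sets built.\<close>

lemma card_mult_le_card_Un:
  assumes "X \<subseteq> Pow A" "Y \<subseteq> Pow B" "A \<inter> B = {}" "C \<inter> (A \<union> B) = {}" "finite F"
    and "\<And>S T. S \<in> X \<Longrightarrow> T \<in> Y \<Longrightarrow> S \<union> T \<union> C \<in> F"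
  shows "card X * card Y \<le> card F"
proof -
  have "S = (S \<union> T \<union> C) \<inter> A" "T = (S \<union> T \<union> C) \<inter> B" if "S \<in> X" "T \<in> Y" for S T
    using assms(1-4) that by blast+
  then have "inj_on (\<lambda>(S, T). S \<union> T \<union> C) (X \<times> Y)"
    by (intro inj_onI) (clarsimp, metis)
  moreover have "(\<lambda>(S, T). S \<union> T \<union> C) ` (X \<times> Y) \<subseteq> F"
    using assms(6) by auto
  ultimately have "card (X \<times> Y) \<le> card F"
    using assms(5) by (meson card_inj_on_le)
  then show ?thesis by (simp add: card_cartesian_product)
qed

section \<open>The excluded independent sets\<close>

text \<open>The interval stops at \<open>2 ^ i - 2\<close> because, for positive \<open>i\<close>,
  \<open>2 ^ i - 1\<close> and \<open>2 ^ i\<close> are neighbours of \<open>2 ^ i + 1\<close>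
  already in the auxiliary graph. The last condition makes \<open>i\<close> the largest such index,
  so that different \<open>i\<close> give disjoint families.\<close>

definition excluded :: "nat \<Rightarrow> nat \<Rightarrow> nat set set" where
  "excluded i N = {S \<in> delta_indep {1..N}.
     2 ^ i + 1 \<in> S \<and> S \<inter> {1..2 ^ i - 2} \<noteq> {} \<and> (\<forall>j>i. 2 ^ j + 1 \<notin> S)}"

lemma excluded_subset: "excluded i N \<subseteq> delta_indep {1..N}"
  by (auto simp: excluded_def)

lemma finite_excluded: "finite (excluded i N)"
  using excluded_subset finite_delta_indep finite_subset by blast

lemma excluded_disjoint: "i \<noteq> j \<Longrightarrow> excluded i N \<inter> excluded j N = {}"
  unfolding excluded_def by (cases i j rule: linorder_cases) auto

text \<open>Deleting \<open>2 ^ i + 1\<close> and its neighbours, which lie within distance 2,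
  leaves \<open>{1..2 ^ i - 2}\<close> and \<open>{2 ^ i + 4..N}\<close>. A nonempty independent set
  in the first and any in the second combine with \<open>2 ^ i + 1\<close>; the next candidate
  \<open>2 ^ (i + 1) + 1\<close> exceeds \<open>N\<close>.\<close>

lemma card_excluded_base:
  assumes "i \<ge> 2" "2 ^ i < N" "N \<le> 2 ^ (i + 1)"
  shows "(delta (2 ^ i - 2) - 1) * delta_tilde (int N - 2 ^ i - 3) \<le> card (excluded i N)"
proof -
  let ?p = "2 ^ i :: nat"
  let ?A = "{1..?p - 2}" and ?B = "{?p + 4..N}" and ?c = "?p + 1"
  have p: "?p \<ge> 4" using assms(1) power_increasing[of 2 i "2::nat"] by simp
  have "card (delta_indep ?A - {{}}) * card (delta_indep ?B) \<le> card (excluded i N)"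
  proof (rule card_mult_le_card_Un)
    show "delta_indep ?A - {{}} \<subseteq> Pow ?A" "delta_indep ?B \<subseteq> Pow ?B"
      using delta_indep_subset_Pow by blast+
    show "?A \<inter> ?B = {}" "{?c} \<inter> (?A \<union> ?B) = {}" using p by auto
    show "finite (excluded i N)" by (rule finite_excluded)
    fix S T assume S: "S \<in> delta_indep ?A - {{}}" and T: "T \<in> delta_indep ?B"
    have "S \<union> T \<in> delta_indep (?A \<union> ?B)"
      using S T p by (intro delta_indep_Un) (auto simp: delta_adj_def)
    then have "(S \<union> T) \<union> {?c} \<in> delta_indep ((?A \<union> ?B) \<union> {?c})"
      by (rule delta_indep_Un[OF _ singleton_in_delta_indep]) (use p in \<open>auto simp: delta_adj_def\<close>)
    then have "S \<union> T \<union> {?c} \<in> delta_indep {1..N}"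
      by (rule delta_indep_mono) (use assms p in auto)
    moreover have "(S \<union> T \<union> {?c}) \<inter> ?A \<noteq> {}" using S unfolding delta_indep_def by blast
    moreover have "2 ^ j + 1 \<notin> S \<union> T \<union> {?c}" if "j > i" for j
    proof -
      have "2 ^ j + 1 > N"
        using assms(3) that power_increasing[of "i + 1" j "2::nat"] by linarith
      then have "2 ^ j + 1 \<notin> {1..N}" by simp
      moreover have "S \<union> T \<union> {?c} \<subseteq> {1..N}"
        using \<open>S \<union> T \<union> {?c} \<in> delta_indep {1..N}\<close> unfolding delta_indep_def by blast
      ultimately show ?thesis by blast
    qed
    ultimately show "S \<union> T \<union> {?c} \<in> excluded i N"
      unfolding excluded_def by blast
  qed
  moreover have "card (delta_indep ?A - {{}}) = delta (?p - 2) - 1"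
    by (simp add: delta_eq_card finite_delta_indep)
  moreover have "card (delta_indep ?B) = delta_tilde (int N - 2 ^ i - 3)"
    using delta_tilde_eq_card[of "?p + 3" N] assms(1) by (simp add: algebra_simps)
  ultimately show ?thesis by simp
qed

text \<open>Leaving out the vertex \<open>2 ^ j + 1\<close> disconnects \<open>{1..2 ^ j}\<close>
  from \<open>{2 ^ j + 2..N}\<close>, so an excluded set in the lower part can be extended by any
  independent set in the upper one. The upper part starts at an even number and contains no
  \<open>2 ^ l + 1\<close>.\<close>

lemma card_excluded_step:
  assumes "i < j" "2 ^ j < N" "N \<le> 2 ^ (j + 1)"
  shows "card (excluded i (2 ^ j)) * delta_tilde (int N - 2 ^ j - 1) \<le> card (excluded i N)"
proof -
  let ?p = "2 ^ j :: nat"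
  let ?B = "{?p + 2..N}"
  have ev: "even ?p" using assms(1) by simp
  have "card (excluded i ?p) * card (delta_indep ?B) \<le> card (excluded i N)"
  proof (rule card_mult_le_card_Un)
    show "excluded i ?p \<subseteq> Pow {1..?p}" "delta_indep ?B \<subseteq> Pow ?B"
      using excluded_subset delta_indep_subset_Pow by blast+
    show "{1..?p} \<inter> ?B = {}" "{} \<inter> ({1..?p} \<union> ?B) = {}" by auto
    show "finite (excluded i N)" by (rule finite_excluded)
    fix S T assume S: "S \<in> excluded i ?p" and T: "T \<in> delta_indep ?B"
    have "S \<union> T \<in> delta_indep ({1..?p} \<union> ?B)"
    proof (rule delta_indep_Un)
      \<comment> \<open>Only \<open>?p\<close> is within distance 2 of \<open>?B\<close>, and being
        even it has no chord to \<open>?p + 2\<close>.\<close>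
      fix u v assume "u \<in> {1..?p}" "v \<in> ?B"
      then show "\<not> delta_adj u v"
        using ev by (cases "u = ?p") (auto simp: delta_adj_def)
    qed (use S T excluded_subset in auto)
    then have "S \<union> T \<union> {} \<in> delta_indep {1..N}"
      unfolding Un_empty_right by (rule delta_indep_mono) (use assms in auto)
    moreover have "2 ^ l + 1 \<notin> T" if "l > i" for l
    proof (cases "l \<le> j")
      case True
      then have "(2::nat) ^ l \<le> ?p" by simp
      then have "2 ^ l + 1 \<notin> ?B" unfolding atLeastAtMost_iff by linarith
      then show ?thesis using T unfolding delta_indep_def by blast
    next
      case False
      then have "(2::nat) ^ (j + 1) \<le> 2 ^ l" by (intro power_increasing) auto
      then have "2 ^ l + 1 \<notin> ?B" using assms(3) unfolding atLeastAtMost_iff by linarith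
      then show ?thesis using T unfolding delta_indep_def by blast
    qed
    ultimately show "S \<union> T \<union> {} \<in> excluded i N"
      using S unfolding excluded_def by auto
  qed
  moreover have "card (delta_indep ?B) = delta_tilde (int N - 2 ^ j - 1)"
    using delta_tilde_eq_card[of "?p + 1" N] ev by (simp add: algebra_simps)
  ultimately show ?thesis by simp
qed

lemma alpha_Suc:
  assumes "i \<le> k"
  shows "alpha (Suc k) i = alpha k i * delta_tilde (2 ^ k - 1)"
proof (cases "i = k")
  case False
  then have "{i..k} = insert k {i..k - 1}" using assms by auto
  then show ?thesis using False assms by (simp add: alpha_def)
qed (simp add: alpha_def)

text \<open>Induction on \<open>k\<close>: at \<open>k = i + 1\<close> the upper part has index
  \<open>2 ^ (i + 1) - 2 ^ i - 3 = 2 ^ i - 3\<close>, and each passage from \<open>2 ^ k\<close> to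
  \<open>2 ^ (k + 1)\<close> contributes the next factor \<open>delta_tilde (2 ^ k - 1)\<close> of
  \<open>alpha\<close>.\<close>

lemma card_excluded_power:
  assumes "i \<ge> 2" "i + 1 \<le> k"
  shows "(delta (2 ^ i - 2) - 1) * delta_tilde (2 ^ i - 3) * alpha k (i + 1)
    \<le> card (excluded i (2 ^ k))"
  using assms(2)
proof (induction k rule: dec_induct)
  case base
  show ?case using card_excluded_base[of i "2 ^ (i + 1)"] assms(1) by (simp add: alpha_def)
next
  case (step k)
  have "(delta (2 ^ i - 2) - 1) * delta_tilde (2 ^ i - 3) * alpha (Suc k) (i + 1)
      = ((delta (2 ^ i - 2) - 1) * delta_tilde (2 ^ i - 3) * alpha k (i + 1)) * delta_tilde (2 ^ k - 1)"
    using step.hyps by (simp add: alpha_Suc)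
  also have "\<dots> \<le> card (excluded i (2 ^ k)) * delta_tilde (2 ^ k - 1)"
    using step.IH by (rule mult_le_mono1)
  also have "\<dots> \<le> card (excluded i (2 ^ Suc k))"
    using card_excluded_step[of i k "2 ^ Suc k"] step.hyps by simp
  finally show ?case .
qed

section \<open>Adjacency in io-decomposable graphs of the Bell type\<close>

text \<open>In the convolution the terms \<open>i\<close> and \<open>2 * s - i\<close> are equal and
  cancel modulo 2; the middle term, the square of the coefficient at \<open>s\<close>,
  remains.\<close>

lemma odd_fps_nth_power2:
  fixes p :: "int fps"
  shows "odd (fps_nth (p ^ 2) (2 * s)) \<longleftrightarrow> odd (fps_nth p s)"
proof -
  let ?f = "\<lambda>i. fps_nth p i * fps_nth p (2 * s - i)"
  have "fps_nth (p ^ 2) (2 * s) = sum ?f {0..2 * s}"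
    by (simp add: power2_eq_square fps_mult_nth)
  also have "{0..2 * s} = {..<s} \<union> ({s} \<union> {s<..2 * s})" by auto
  also have "sum ?f \<dots> = sum ?f {..<s} + (?f s + sum ?f {s<..2 * s})"
    by (subst sum.union_disjoint; (subst sum.union_disjoint)?) auto
  also have "sum ?f {s<..2 * s} = sum ?f {..<s}"
    by (rule sum.reindex_bij_witness[of _ "\<lambda>i. 2 * s - i" "\<lambda>i. 2 * s - i"]) auto
  finally show ?thesis by simp
qed

lemma strict_mono_image_interval_id:
  fixes h :: "nat \<Rightarrow> nat"
  assumes mono: "strict_mono_on {1..N} h" and im: "h ` {1..N} \<subseteq> {1..N}" and i: "i \<in> {1..N}"
  shows "h i = i"
proof (rule antisym)
  have "1 \<le> j \<longrightarrow> j \<le> N \<longrightarrow> j \<le> h j" for j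
  proof (induction j)
    case (Suc j)
    show ?case
    proof (intro impI)
      assume "1 \<le> Suc j" "Suc j \<le> N"
      then show "Suc j \<le> h (Suc j)"
        using Suc strict_mono_onD[OF mono, of j "Suc j"] im by (cases "j = 0") force+
    qed
  qed simp
  then show "i \<le> h i" using i by simp
  \<comment> \<open>The upper bound is proved by descending from the top, \<open>d\<close> being the
    distance to \<open>N\<close>.\<close>
  have "d < N \<longrightarrow> h (N - d) \<le> N - d" for d
  proof (induction d)
    case (Suc d)
    show ?case
    proof
      assume "Suc d < N"
      then show "h (N - Suc d) \<le> N - Suc d"
        using Suc strict_mono_onD[OF mono, of "N - Suc d" "N - d"] by fastforce
    qed
  qed (use im in \<open>simp add: image_subset_iff\<close>)
  from this[of "N - i"] show "h i \<le> i" using i by simp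
qed

lemma dominates_riordan_graph:
  assumes "i \<in> {1..n}" "j \<in> {1..n}" "j < i"
  shows "i \<rightarrow>\<^bsub>riordan_graph n g f\<^esub> j \<longleftrightarrow> odd (fps_nth (g * f ^ (j - 1)) (i - 2))"
  using assms by (auto simp: riordan_graph_def dominates_graph_on)

lemma dominates_riordan_graph_commute:
  "u \<rightarrow>\<^bsub>riordan_graph n g f\<^esub> v \<longleftrightarrow> v \<rightarrow>\<^bsub>riordan_graph n g f\<^esub> u"
  by (auto simp: riordan_graph_def dominates_graph_on)

text \<open>Since \<open>g * (z * g) ^ (j - 1) = z ^ (j - 1) * g ^ j\<close>, adjacency is the
  parity of a coefficient of a pure power of \<open>g\<close>, to which the squaring rule
  applies.\<close>

lemma dominates_riordan_Bell:
  assumes "i \<in> {1..n}" "j \<in> {1..n}" "j < i"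
  shows "i \<rightarrow>\<^bsub>riordan_graph n g (fps_X * g)\<^esub> j \<longleftrightarrow> odd (fps_nth (g ^ j) (i - j - 1))"
proof -
  have "g * (fps_X * g) ^ (j - 1) = fps_X ^ (j - 1) * g ^ j"
    using assms(2) by (cases j) (simp_all add: power_mult_distrib mult_ac)
  moreover have "fps_nth (fps_X ^ (j - 1) * g ^ j) (i - 2) = fps_nth (g ^ j) (i - 2 - (j - 1))"
    using assms by (subst fps_X_power_mult_nth) auto
  moreover have "i - 2 - (j - 1) = i - j - 1" using assms by auto
  ultimately show ?thesis by (simp only: dominates_riordan_graph[OF assms])
qed

lemma io_decomposable_doubling:
  assumes io: "io_decomposable n g f"
    and i: "2 * i - 1 \<le> n" "i \<ge> 1" and j: "2 * j - 1 \<le> n" "j \<ge> 1"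
    and dom: "i \<rightarrow>\<^bsub>riordan_graph n g f\<^esub> j"
  shows "(2 * i - 1) \<rightarrow>\<^bsub>riordan_graph n g f\<^esub> (2 * j - 1)"
proof -
  let ?V = "{v \<in> {1..n}. odd v}"
  define N where "N = nat \<lceil>real n / 2\<rceil>"
  let ?G = "riordan_graph n g f \<restriction> ?V" and ?H = "riordan_graph N g f"
  have N: "N = (n + 1) div 2" unfolding N_def by linarith
  obtain h where h: "pre_digraph.digraph_isomorphism ?G h" "?H = app_iso h ?G"
    and mono: "strict_mono_on ?V (iso_verts h)"
    using io unfolding io_decomposable_def labelled_iso_def N_def by auto
  have "verts ?H = iso_verts h ` ?V" by (simp only: h(2) verts_app_iso induce_subgraph_verts)
  then have im: "iso_verts h ` ?V = {1..N}" by (simp add: riordan_graph_def)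
  \<comment> \<open>The map from \<open>l\<close> to the image of \<open>2 * l - 1\<close> is an
    increasing self-map of \<open>{1..N}\<close>, hence the identity.\<close>
  have id: "iso_verts h (2 * l - 1) = l" if "l \<in> {1..N}" for l
  proof (rule strict_mono_image_interval_id[OF _ _ that])
    have V: "2 * l - 1 \<in> ?V" if "l \<in> {1..N}" for l using that N by auto
    show "strict_mono_on {1..N} (\<lambda>l. iso_verts h (2 * l - 1))"
      using V by (intro strict_mono_onI strict_mono_onD[OF mono]) auto
    show "(\<lambda>l. iso_verts h (2 * l - 1)) ` {1..N} \<subseteq> {1..N}"
      using V im by blast
  qed
  have ij: "i \<in> {1..N}" "j \<in> {1..N}" using i j N by auto
  interpret wf_digraph ?G
    using h(1) by (simp add: pre_digraph.digraph_isomorphism_def)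
  have "i \<rightarrow>\<^bsub>?H\<^esub> j" using dom ij by (auto simp: riordan_graph_def dominates_graph_on)
  \<comment> \<open>The edge is pulled back along \<open>h\<close>; its endpoints are odd, and
    \<open>id\<close> identifies them as \<open>2 * i - 1\<close> and
    \<open>2 * j - 1\<close>.\<close>
  then obtain u v where uv: "u \<rightarrow>\<^bsub>?G\<^esub> v" "iso_verts h u = i" "iso_verts h v = j"
    unfolding h(2) arcs_ends_app_iso_eq[OF h(1)] by auto
  have "u \<in> ?V" "v \<in> ?V" using uv(1) adj_in_verts by (auto simp only: induce_subgraph_verts)
  moreover from this obtain a b where ab: "u = 2 * a - 1" "v = 2 * b - 1" "a \<in> {1..N}" "b \<in> {1..N}"
  proof -
    assume "\<And>a b. u = 2 * a - 1 \<Longrightarrow> v = 2 * b - 1 \<Longrightarrow> a \<in> {1..N} \<Longrightarrow> b \<in> {1..N} \<Longrightarrow> thesis"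
    from this[of "(u + 1) div 2" "(v + 1) div 2"] show thesis
      using \<open>u \<in> ?V\<close> \<open>v \<in> ?V\<close> N by (auto elim!: oddE)
  qed
  ultimately have "a = i" "b = j" using uv id by auto
  with ab(1,2) dominates_induce_subgraphD[OF uv(1)] show ?thesis by (simp only:)
qed

text \<open>The coefficient concerned is the constant term of \<open>g ^ i\<close>, a power of an
  odd number.\<close>

lemma riordan_Bell_consecutive:
  assumes "odd (fps_nth g 0)" "1 \<le> i" "i + 1 \<le> n"
  shows "(i + 1) \<rightarrow>\<^bsub>riordan_graph n g (fps_X * g)\<^esub> i"
  using assms by (subst dominates_riordan_Bell) (auto simp: fps_nth_power_0)

text \<open>The path edges come from consecutive vertices, and the chord from
  \<open>2 * m + 1\<close> to \<open>2 * m + 3\<close> is the double of the path edge from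
  \<open>m + 1\<close> to \<open>m + 2\<close>.\<close>

lemma io_Bell_delta_adj:
  assumes io: "io_decomposable n g (fps_X * g)"
    and "u \<in> {1..n}" "v \<in> {1..n}" "delta_adj u v"
  shows "u \<rightarrow>\<^bsub>riordan_graph n g (fps_X * g)\<^esub> v"
proof -
  let ?G = "riordan_graph n g (fps_X * g)"
  have g0: "odd (fps_nth g 0)" using io by (simp add: io_decomposable_def proper_riordan_def)
  have 1: "v \<rightarrow>\<^bsub>?G\<^esub> u" if "1 \<le> u" "v = u + 1" "v \<le> n" for u v
    using riordan_Bell_consecutive[OF g0, of u n] that by simp
  have 2: "v \<rightarrow>\<^bsub>?G\<^esub> u" if "odd u" "v = u + 2" "v \<le> n" for u v
  proof -
    obtain m where m: "u = 2 * m + 1" using \<open>odd u\<close> by (rule oddE)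
    have "(m + 2) \<rightarrow>\<^bsub>?G\<^esub> (m + 1)" using 1[of "m + 1" "m + 2"] that m by simp
    from io_decomposable_doubling[OF io _ _ _ _ this] show ?thesis using that m by simp
  qed
  show ?thesis using assms(2-4) 1 2 dominates_riordan_graph_commute
    unfolding delta_adj_def by (metis atLeastAtMost_iff)
qed

lemma io_Bell_universal:
  assumes io: "io_decomposable n g (fps_X * g)"
    and "2 ^ i + 1 \<le> n" "1 \<le> j" "j \<le> 2 ^ i"
  shows "(2 ^ i + 1) \<rightarrow>\<^bsub>riordan_graph n g (fps_X * g)\<^esub> j"
  using assms(2-)
proof (induction i arbitrary: j)
  case 0
  then show ?case using riordan_Bell_consecutive[of g 1 n] io
    by (simp add: io_decomposable_def proper_riordan_def)
next
  case (Suc i)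
  \<comment> \<open>Both \<open>2 * m - 1\<close> and \<open>2 * m\<close> halve to
    \<open>m\<close>, so one instance of the induction hypothesis serves either parity of
    \<open>j\<close>.\<close>
  define m where "m = (j + 1) div 2"
  have m: "1 \<le> m" "m \<le> 2 ^ i" "2 ^ i + 1 \<le> n" using Suc.prems by (auto simp: m_def)
  note IH = Suc.IH[OF m(3,1,2)]
  show ?case
  proof (cases "odd j")
    case True
    then have "j = 2 * m - 1" by (auto simp: m_def elim: oddE)
    then show ?thesis using io_decomposable_doubling[OF io _ _ _ _ IH] Suc.prems m by simp
  next
    case False
    then have j: "j = 2 * m" by (auto simp: m_def)
    \<comment> \<open>Squaring \<open>g ^ m\<close> doubles the exponent of \<open>z\<close> while
      preserving parity, which turns adjacency to \<open>m\<close> into adjacency to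
      \<open>2 * m\<close>.\<close>
    have "odd (fps_nth (g ^ m) (2 ^ i - m))"
      using IH dominates_riordan_Bell[of "2 ^ i + 1" n m g] m by simp
    then have "odd (fps_nth ((g ^ m) ^ 2) (2 * (2 ^ i - m)))"
      by (simp add: odd_fps_nth_power2)
    moreover have "(g ^ m) ^ 2 = g ^ j" by (simp add: j mult.commute flip: power_mult)
    moreover have "2 * (2 ^ i - m) = 2 ^ Suc i + 1 - j - 1" using m by (simp add: j algebra_simps)
    ultimately show ?thesis
      using Suc.prems dominates_riordan_Bell[of "2 ^ Suc i + 1" n j g] by simp
  qed
qed

section \<open>Assembling the bound\<close>

text \<open>The independent sets of the Riordan graph and the families \<open>excluded i n\<close>
  are pairwise disjoint subfamilies of the independent sets counted by
  \<open>delta n\<close>.\<close>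

lemma io_Bell_indep_count:
  assumes io: "io_decomposable n g (fps_X * g)" and "finite I"
  shows "num_independent_sets (riordan_graph n g (fps_X * g)) + (\<Sum>i\<in>I. card (excluded i n)) \<le> delta n"
proof -
  let ?G = "riordan_graph n g (fps_X * g)"
  let ?S = "{S. independent_set ?G S}" and ?E = "\<Union>i\<in>I. excluded i n"
  have S: "S \<subseteq> {1..n}" "\<And>u v. u \<in> S \<Longrightarrow> v \<in> S \<Longrightarrow> \<not> u \<rightarrow>\<^bsub>?G\<^esub> v" if "S \<in> ?S" for S
    using that by (auto simp: independent_set_def riordan_graph_def)
  have sub: "?S \<subseteq> delta_indep {1..n}"
  proof
    fix S assume "S \<in> ?S"
    then show "S \<in> delta_indep {1..n}"
      using S[of S] io_Bell_delta_adj[OF io] unfolding delta_indep_def by (simp add: subset_iff) metis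
  qed
  have "S \<notin> excluded i n" if "S \<in> ?S" for S i
  proof
    assume "S \<in> excluded i n"
    then obtain j where j: "2 ^ i + 1 \<in> S" "j \<in> S" "1 \<le> j" "j \<le> 2 ^ i - 2"
      unfolding excluded_def by auto
    then have "(2 ^ i + 1) \<rightarrow>\<^bsub>?G\<^esub> j"
      using io_Bell_universal[OF io, of i j] S(1)[OF that] by auto
    with S(2)[OF that] j show False by blast
  qed
  then have "?S \<inter> ?E = {}" by blast
  moreover have fin: "finite ?S" "finite ?E"
    using sub finite_delta_indep[of "{1..n}"] finite_subset assms(2) finite_excluded by auto
  moreover have "card ?E = (\<Sum>i\<in>I. card (excluded i n))"
    using assms(2) finite_excluded excluded_disjoint by (intro card_UN_disjoint) auto
  ultimately have "card ?S + (\<Sum>i\<in>I. card (excluded i n)) = card (?S \<union> ?E)"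
    by (simp add: card_Un_disjoint)
  also have "\<dots> \<le> card (delta_indep {1..n})"
    using sub excluded_subset by (intro card_mono finite_delta_indep) auto
  finally show ?thesis by (simp add: num_independent_sets_def delta_eq_card)
qed

text \<open>This makes \<open>delta n - 1\<close> on naturals agree with the integer difference in
  the theorem.\<close>

lemma delta_pos: "delta n \<ge> 1"
proof -
  have "delta_indep {1..n} \<noteq> {}" using empty_in_delta_indep by blast
  then show ?thesis by (simp add: delta_eq_card finite_delta_indep Suc_le_eq card_gt_0_iff)
qed

theorem theorem3p5:
  fixes g :: "int fps" and n k :: nat
  assumes "io_decomposable n g (fps_X * g)"
    and "k \<ge> 2"
    and "2 ^ k < n" and "n \<le> 2 ^ (k + 1)"
  shows "int (num_independent_sets (riordan_graph n g (fps_X * g)))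
      \<le> int (delta n)
        - (int (delta (2 ^ k - 2)) - 1) * int (delta_tilde (int n - 2 ^ k - 3))
        - int (delta_tilde (int n - 2 ^ k - 1)) *
          (\<Sum>i = 1..k - 1. (int (delta (2 ^ i - 2)) - 1) * int (delta_tilde (2 ^ i - 3)) *
             int (alpha k (i + 1)))"
proof -
  define t where "t i = (delta (2 ^ i - 2) - 1) * delta_tilde (2 ^ i - 3) * alpha k (i + 1)" for i
  let ?d = "delta_tilde (int n - 2 ^ k - 1)"
  \<comment> \<open>The count at \<open>2 ^ k\<close> is carried to \<open>n\<close> by one last
    extension, which contributes the factor \<open>?d\<close>.\<close>
  have t: "t i * ?d \<le> card (excluded i n)" if "2 \<le> i" "i < k" for i
  proof -
    have "t i * ?d \<le> card (excluded i (2 ^ k)) * ?d"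
      unfolding t_def using card_excluded_power[of i k] that by (intro mult_le_mono1) simp
    also have "\<dots> \<le> card (excluded i n)"
      using card_excluded_step[of i k n] that assms by simp
    finally show ?thesis .
  qed
  \<comment> \<open>The term at \<open>i = 1\<close> vanishes because \<open>delta 0 = 1\<close>;
    the counting lemmas start at \<open>i = 2\<close>.\<close>
  have "(\<Sum>i = 1..k - 1. t i) = (\<Sum>i = 2..k - 1. t i)"
    using assms(2) by (simp add: sum.atLeast_Suc_atMost t_def delta_def numeral_2_eq_2)
  then have "?d * (\<Sum>i = 1..k - 1. t i) = (\<Sum>i = 2..k - 1. t i * ?d)"
    by (simp add: sum_distrib_right mult.commute)
  also have "\<dots> \<le> (\<Sum>i = 2..k - 1. card (excluded i n))"
    by (intro sum_mono t) auto
  \<comment> \<open>The class \<open>i = k\<close> is bounded directly by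
    \<open>card_excluded_base\<close>, as \<open>n\<close> lies between \<open>2 ^ k\<close> and
    \<open>2 ^ (k + 1)\<close>.\<close>
  finally have "num_independent_sets (riordan_graph n g (fps_X * g))
      + ((delta (2 ^ k - 2) - 1) * delta_tilde (int n - 2 ^ k - 3) + ?d * (\<Sum>i = 1..k - 1. t i))
    \<le> num_independent_sets (riordan_graph n g (fps_X * g))
      + (card (excluded k n) + (\<Sum>i = 2..k - 1. card (excluded i n)))"
    using card_excluded_base[of k n] assms by (intro add_mono) auto
  also have "card (excluded k n) + (\<Sum>i = 2..k - 1. card (excluded i n))
      = (\<Sum>i\<in>insert k {2..k - 1}. card (excluded i n))"
    using assms(2) by (subst sum.insert) auto
  also have "num_independent_sets (riordan_graph n g (fps_X * g)) + \<dots> \<le> delta n"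
    by (rule io_Bell_indep_count[OF assms(1)]) simp
  finally have "int (num_independent_sets (riordan_graph n g (fps_X * g))
      + ((delta (2 ^ k - 2) - 1) * delta_tilde (int n - 2 ^ k - 3) + ?d * (\<Sum>i = 1..k - 1. t i)))
    \<le> int (delta n)"
    by (rule of_nat_mono)
  then show ?thesis
    using delta_pos by (simp add: t_def of_nat_diff)
qed

end
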